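(* Let $\Gamma=N+S$ and let $g$ denote the genus of the modular curve $X(\Gamma)$. Assume that $i\infty$ is not a Weierstrass point on $X(\Gamma)$. Let $m\ge g+1$ and $n\ge -g$ be integers. Then $$a_\Gamma(m,n)=-b_\Gamma(n,m).$$
   Context: For a positive integer $N$ and a set $S$ of exact divisors $Q$ of $N$ ($Q\mid N$, $\gcd(Q,N/Q)=1$), $\Gamma=N+S$ is the subgroup of $\mathrm{PSL}_2(\mathbb R)$ generated by $\Gamma_0(N)$ and the Atkin-Lehner involutions $W_{Q,N}=\begin{pmatrix}Qx&y\\ Nz&Qw\end{pmatrix}$ ($x,y,z,w\in\mathbb Z$, determinant $Q$) for all $Q\in S$. $X(\Gamma)$ is the modular curve corresponding to $\Gamma$, i.e. the compactification of $\Gamma\backslash\mathbb H$ by the cusps; $\tau\in\mathbb H$ and $q=e^{2\pi i\tau}$. $M_0^{!,\infty}(\Gamma)$ is the space of weakly holomorphic modular functions on $\Gamma$ whose poles are supported only at $i\infty$ and which are holomorphic at the other cusps; $S_2^{!,\infty}(\Gamma)$ is the space of weight $2$ weakly holomorphic modular forms on $\Gamma$ whose poles are supported only at $i\infty$ and which vanish at the other cusps. $S_2(\Gamma)$ is the space of weight $2$ cusp forms on $\Gamma$. The coefficients $a_\Gamma(m,n)$: for each $m\ge g+1$, $f_{\Gamma,m}$ is the unique function in $M_0^{!,\infty}(\Gamma)$ of the form $$f_{\Gamma,m}=q^{-m}+\sum_{l=1}^g a_\Gamma(m,-l)q^{-l}+\sum_{n\ge1}a_\Gamma(m,n)q^n,$$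 so its constant term is zero. When $g=0$, this is the unique function $J_{\Gamma,m}=q^{-m}+O(q)$ in $M_0^{!,\infty}(\Gamma)$. The coefficients $b_\Gamma(n,m)$: when $g>0$, $S_2(\Gamma)$ has a unique basis $\{h_{\Gamma,-l}\}_{1\le l\le g}$ with $h_{\Gamma,-l}=q^l+\sum_{m\ge g+1}b_\Gamma(-l,m)q^m$. Using linear combinations of products of the $f_{\Gamma,m}$ and the $h_{\Gamma,-l}$, one takes, for each integer $n\ge -g$, $h_{\Gamma,n}$ to be the unique form in $S_2^{!,\infty}(\Gamma)$ with $$h_{\Gamma,n}=q^{-n}+\sum_{m\ge g+1}b_\Gamma(n,m)q^m.$$ When $g=0$, $h_{\Gamma,n}$ is obtained by differentiating $J_{\Gamma,n}$ with respect to $\tau$ and normalizing. The $h_{\Gamma,n}$ are taken as a basis for $S_2^{!,\infty}(\Gamma)$. *)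

theory Defs
  imports "HOL-Analysis.Analysis" "HOL-Homology.Homology"
begin

section \<open>The groups \<open>N+S\<close>\<close>

definition mat22 :: "real \<Rightarrow> real \<Rightarrow> real \<Rightarrow> real \<Rightarrow> real^2^2" where
  "mat22 a b c d = vector [vector [a, b], vector [c, d]]"

definition SL2R :: "(real^2^2) monoid" where
  "SL2R = \<lparr>carrier = {A. det A = 1}, monoid.mult = (**), one = mat 1\<rparr>"

lemma group_SL2R: "group SL2R"
proof (rule groupI)
  fix x assume "x \<in> carrier SL2R"
  then have dx: "det x = 1" by (simp add: SL2R_def)
  then obtain y where y: "y ** x = mat 1" "x ** y = mat 1"
    by (metis invertible_det_nz invertible_def zero_neq_one)
  then have "det y * det x = 1" by (metis det_I det_mul)
  with y dx have "y \<in> carrier SL2R" "y \<otimes>\<^bsub>SL2R\<^esub> x = \<one>\<^bsub>SL2R\<^esub>"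
    by (simp_all add: SL2R_def)
  then show "\<exists>y\<in>carrier SL2R. y \<otimes>\<^bsub>SL2R\<^esub> x = \<one>\<^bsub>SL2R\<^esub>" by blast
qed (simp_all add: SL2R_def det_mul matrix_mul_assoc)

definition Gamma0 :: "nat \<Rightarrow> (real^2^2) set" where
  "Gamma0 N = {mat22 (of_int a) (of_int b) (of_int c) (of_int d) | a b c d :: int.
                 a * d - b * c = 1 \<and> int N dvd c}"

abbreviation SL2Z :: "(real^2^2) set" where
  "SL2Z \<equiv> Gamma0 1"

definition exact_divisors :: "nat \<Rightarrow> nat set" where
  "exact_divisors N = {Q. Q dvd N \<and> coprime Q (N div Q)}"

text \<open>The integral matrices \<open>W\<^sub>Q\<close> have determinant \<open>Q\<close>; here they are divided by the square
  root of \<open>Q\<close>, so that they lie in the special linear group.\<close>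

definition Atkin_Lehner :: "nat \<Rightarrow> nat \<Rightarrow> (real^2^2) set" where
  "Atkin_Lehner N Q =
     {mat22 (of_int (int Q * x) / sqrt Q) (of_int y / sqrt Q)
            (of_int (int N * z) / sqrt Q) (of_int (int Q * w) / sqrt Q) | x y z w :: int.
        (int Q * x) * (int Q * w) - y * (int N * z) = int Q}"

text \<open>All generators below come together with their negatives, so this subgroup of
  the special linear group is the full preimage of the subgroup \<open>N+S\<close> of the projective group.\<close>

definition N_plus :: "nat \<Rightarrow> nat set \<Rightarrow> (real^2^2) set" where
  "N_plus N S = generate SL2R (Gamma0 N \<union> (\<Union>Q\<in>S. Atkin_Lehner N Q))"


section \<open>The modular curve as a topological space\<close>

text \<open>The projective line over the complex numbers is represented by the option type,
  with \<open>None\<close> playing the role of the point at infinity.\<close>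

definition moebius :: "real^2^2 \<Rightarrow> complex option \<Rightarrow> complex option" where
  "moebius A x = (case x of
      None \<Rightarrow> if A$2$1 = 0 then None else Some (of_real (A$1$1 / A$2$1))
    | Some z \<Rightarrow> if of_real (A$2$1) * z + of_real (A$2$2) = 0 then None
        else Some ((of_real (A$1$1) * z + of_real (A$1$2)) / (of_real (A$2$1) * z + of_real (A$2$2))))"

definition upper_half_plane :: "complex set" where
  "upper_half_plane = {z. 0 < Im z}"

definition ext_upper_half_plane :: "complex option set" where
  "ext_upper_half_plane = insert None (Some ` (upper_half_plane \<union> \<rat>))"

text \<open>The usual topology on the extended upper half plane: neighbourhoods of infinity contain a
  half plane, and neighbourhoods of a rational number contain an open disc tangent to the real
  line at that number.\<close>

definition open_ext :: "complex option set \<Rightarrow> bool" where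
  "open_ext U \<longleftrightarrow> U \<subseteq> ext_upper_half_plane
     \<and> open {z \<in> upper_half_plane. Some z \<in> U}
     \<and> (None \<in> U \<longrightarrow> (\<exists>c>0. \<forall>z. c < Im z \<longrightarrow> Some z \<in> U))
     \<and> (\<forall>r::rat. Some (of_rat r) \<in> U \<longrightarrow>
          (\<exists>e>0. \<forall>z \<in> ball (Complex (of_rat r) e) e. Some z \<in> U))"

definition orbit :: "(real^2^2) set \<Rightarrow> complex option \<Rightarrow> complex option set" where
  "orbit G x = (\<lambda>A. moebius A x) ` G"

definition modular_curve :: "(real^2^2) set \<Rightarrow> complex option set topology" where
  "modular_curve G = topology (\<lambda>U. U \<subseteq> orbit G ` ext_upper_half_plane
      \<and> open_ext {x \<in> ext_upper_half_plane. orbit G x \<in> U})"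

lemma tangent_disc_mono:
  assumes "0 < (d::real)" "d \<le> e"
  shows "ball (Complex r d) d \<subseteq> ball (Complex r e) e"
proof
  fix z assume "z \<in> ball (Complex r d) d"
  then have "dist (Complex r d) z < d" by simp
  moreover have "dist (Complex r e) (Complex r d) = e - d"
    using assms by (simp add: dist_complex_def complex_diff complex_norm)
  moreover have "dist (Complex r e) z \<le> dist (Complex r e) (Complex r d) + dist (Complex r d) z"
    by (rule dist_triangle)
  ultimately show "z \<in> ball (Complex r e) e" by simp
qed

lemma open_ext_Int:
  assumes S: "open_ext S" and T: "open_ext T"
  shows "open_ext (S \<inter> T)"
  unfolding open_ext_def
proof (intro conjI allI impI)
  show "S \<inter> T \<subseteq> ext_upper_half_plane" using S by (auto simp: open_ext_def)
  have "{z \<in> upper_half_plane. Some z \<in> S \<inter> T}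
      = {z \<in> upper_half_plane. Some z \<in> S} \<inter> {z \<in> upper_half_plane. Some z \<in> T}" by auto
  then show "open {z \<in> upper_half_plane. Some z \<in> S \<inter> T}"
    using S T by (auto simp: open_ext_def)
next
  assume "None \<in> S \<inter> T"
  then obtain c d where "c > 0" "\<forall>z. c < Im z \<longrightarrow> Some z \<in> S" "d > 0" "\<forall>z. d < Im z \<longrightarrow> Some z \<in> T"
    using S T unfolding open_ext_def by (metis IntD1 IntD2)
  then show "\<exists>c>0. \<forall>z. c < Im z \<longrightarrow> Some z \<in> S \<inter> T"
    by (intro exI[of _ "max c d"]) auto
next
  fix r :: rat assume "Some (of_rat r) \<in> S \<inter> T"
  then obtain d e where de: "d > 0" "\<forall>z\<in>ball (Complex (of_rat r) d) d. Some z \<in> S"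
      "e > 0" "\<forall>z\<in>ball (Complex (of_rat r) e) e. Some z \<in> T"
    using S T unfolding open_ext_def by (metis IntD1 IntD2)
  have "\<forall>z\<in>ball (Complex (of_rat r) (min d e)) (min d e). Some z \<in> S \<inter> T"
    using de tangent_disc_mono[of "min d e" d "of_rat r"] tangent_disc_mono[of "min d e" e "of_rat r"]
    by (metis IntI min.cobounded1 min.cobounded2 min_less_iff_conj subsetD)
  then show "\<exists>e>0. \<forall>z\<in>ball (Complex (of_rat r) e) e. Some z \<in> S \<inter> T"
    using de by (intro exI[of _ "min d e"]) auto
qed

lemma open_ext_Union:
  assumes K: "\<And>S. S \<in> K \<Longrightarrow> open_ext S"
  shows "open_ext (\<Union>K)"
  unfolding open_ext_def
proof (intro conjI allI impI)
  show "\<Union>K \<subseteq> ext_upper_half_plane" using K unfolding open_ext_def by blast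
  have "{z \<in> upper_half_plane. Some z \<in> \<Union>K} = (\<Union>S\<in>K. {z \<in> upper_half_plane. Some z \<in> S})"
    by auto
  then show "open {z \<in> upper_half_plane. Some z \<in> \<Union>K}"
    using K by (auto simp: open_ext_def)
next
  assume "None \<in> \<Union>K"
  then obtain S where S: "S \<in> K" "None \<in> S" by blast
  with K[OF S(1)] show "\<exists>c>0. \<forall>z. c < Im z \<longrightarrow> Some z \<in> \<Union>K"
    unfolding open_ext_def by blast
next
  fix r :: rat assume "Some (of_rat r) \<in> \<Union>K"
  then obtain S where S: "S \<in> K" "Some (of_rat r) \<in> S" by blast
  with K[OF S(1)] show "\<exists>e>0. \<forall>z\<in>ball (Complex (of_rat r) e) e. Some z \<in> \<Union>K"
    unfolding open_ext_def by blast
qed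

lemma openin_modular_curve:
  "openin (modular_curve G) U \<longleftrightarrow> U \<subseteq> orbit G ` ext_upper_half_plane
      \<and> open_ext {x \<in> ext_upper_half_plane. orbit G x \<in> U}"
proof -
  let ?P = "\<lambda>U. {x \<in> ext_upper_half_plane. orbit G x \<in> U}"
  have I: "?P (S \<inter> T) = ?P S \<inter> ?P T" for S T by auto
  have U: "?P (\<Union>K) = \<Union>(?P ` K)" for K by auto
  have "istopology (\<lambda>U. U \<subseteq> orbit G ` ext_upper_half_plane \<and> open_ext (?P U))"
    unfolding istopology_def
  proof (intro conjI allI impI)
    fix K assume "\<forall>S\<in>K. S \<subseteq> orbit G ` ext_upper_half_plane \<and> open_ext (?P S)"
    then show "\<Union>K \<subseteq> orbit G ` ext_upper_half_plane" "open_ext (?P (\<Union>K))"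
      unfolding U by (blast, intro open_ext_Union) auto
  qed (use I open_ext_Int in auto)
  then show ?thesis by (simp add: modular_curve_def)
qed

text \<open>The first integral homology group of a closed orientable surface of genus \<open>g\<close> is free
  abelian of rank \<open>2g\<close>.\<close>

definition genus :: "'a topology \<Rightarrow> nat" where
  "genus X = (THE g. homology_group 1 X \<cong> free_Abelian_group {..<2 * g})"


section \<open>The complex structure and Weierstrass points\<close>

text \<open>The Riemann surface structure on the modular curve is given by its sheaf of holomorphic
  functions. A continuous function on an open set is holomorphic iff its
  pullback to the upper half plane is: at elliptic points a holomorphic function of the
  chart \<open>w\<^sup>e\<close> is the same as a holomorphic function of \<open>w\<close> invariant under the stabiliser,
  and at cusps continuity makes the singularity removable.\<close>

definition modular_curve_holomorphic ::
    "(real^2^2) set \<Rightarrow> complex option set set \<Rightarrow> (complex option set \<Rightarrow> complex) \<Rightarrow> bool" where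
  "modular_curve_holomorphic G U F \<longleftrightarrow> openin (modular_curve G) U
     \<and> continuous_map (subtopology (modular_curve G) U) euclidean F
     \<and> (\<lambda>z. F (orbit G (Some z))) holomorphic_on {z \<in> upper_half_plane. orbit G (Some z) \<in> U}"

text \<open>In the following, \<open>hol U F\<close> means that \<open>F\<close> is holomorphic on the open subset \<open>U\<close> of the
  Riemann surface \<open>X\<close>.\<close>

definition local_coordinate ::
    "('a set \<Rightarrow> ('a \<Rightarrow> complex) \<Rightarrow> bool) \<Rightarrow> 'a \<Rightarrow> 'a set \<Rightarrow> ('a \<Rightarrow> complex) \<Rightarrow> bool" where
  "local_coordinate hol p U u \<longleftrightarrow> p \<in> U \<and> hol U u \<and> inj_on u U \<and> u p = 0"

definition pole_order_at_most ::
    "('a set \<Rightarrow> ('a \<Rightarrow> complex) \<Rightarrow> bool) \<Rightarrow> 'a \<Rightarrow> nat \<Rightarrow> ('a \<Rightarrow> complex) \<Rightarrow> bool" where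
  "pole_order_at_most hol p k F \<longleftrightarrow>
     (\<exists>U u H. local_coordinate hol p U u \<and> hol U H \<and> (\<forall>x\<in>U - {p}. H x = u x ^ k * F x))"

text \<open>A point \<open>p\<close> is a Weierstrass point if there is a nonconstant meromorphic function whose only
  pole is at \<open>p\<close>, of order at most the genus.\<close>

definition weierstrass_point ::
    "'a topology \<Rightarrow> ('a set \<Rightarrow> ('a \<Rightarrow> complex) \<Rightarrow> bool) \<Rightarrow> 'a \<Rightarrow> bool" where
  "weierstrass_point X hol p \<longleftrightarrow> p \<in> topspace X \<and>
     (\<exists>F. hol (topspace X - {p}) F \<and> pole_order_at_most hol p (genus X) F
          \<and> \<not> F constant_on (topspace X - {p}))"


section \<open>Weakly holomorphic modular forms\<close>

definition moebius_upper :: "real^2^2 \<Rightarrow> complex \<Rightarrow> complex" where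
  "moebius_upper A z =
     (of_real (A$1$1) * z + of_real (A$1$2)) / (of_real (A$2$1) * z + of_real (A$2$2))"

definition slash :: "int \<Rightarrow> (complex \<Rightarrow> complex) \<Rightarrow> real^2^2 \<Rightarrow> complex \<Rightarrow> complex" where
  "slash k f A z = (of_real (A$2$1) * z + of_real (A$2$2)) powi (-k) * f (moebius_upper A z)"

text \<open>Expansion in powers of \<open>exp(2\<pi>iz/w)\<close> with finite principal part.\<close>

definition has_q_expansion :: "nat \<Rightarrow> (complex \<Rightarrow> complex) \<Rightarrow> (int \<Rightarrow> complex) \<Rightarrow> bool" where
  "has_q_expansion w f c \<longleftrightarrow> 0 < w \<and> finite {n. n < 0 \<and> c n \<noteq> 0} \<and>
     (\<forall>z\<in>upper_half_plane.
        ((\<lambda>n. c n * exp (2 * of_real pi * \<i> * of_int n * z / of_nat w)) has_sum f z) UNIV)"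

definition meromorphic_at_infinity :: "(complex \<Rightarrow> complex) \<Rightarrow> bool" where
  "meromorphic_at_infinity f \<longleftrightarrow> (\<exists>w c. has_q_expansion w f c)"

definition holomorphic_at_infinity :: "(complex \<Rightarrow> complex) \<Rightarrow> bool" where
  "holomorphic_at_infinity f \<longleftrightarrow> (\<exists>w c. has_q_expansion w f c \<and> (\<forall>n<0. c n = 0))"

definition vanishes_at_infinity :: "(complex \<Rightarrow> complex) \<Rightarrow> bool" where
  "vanishes_at_infinity f \<longleftrightarrow> (\<exists>w c. has_q_expansion w f c \<and> (\<forall>n\<le>0. c n = 0))"

text \<open>Modular forms are functions on the upper half plane; their values elsewhere are irrelevant.
  The cusps are the images of infinity under the elements of the modular group.\<close>

definition weakly_holomorphic_forms :: "int \<Rightarrow> (real^2^2) set \<Rightarrow> (complex \<Rightarrow> complex) set" where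
  "weakly_holomorphic_forms k G = {f. f holomorphic_on upper_half_plane
     \<and> (\<forall>A\<in>G. \<forall>z\<in>upper_half_plane. slash k f A z = f z)
     \<and> (\<forall>A\<in>SL2Z. meromorphic_at_infinity (slash k f A))}"

definition M0_weak_infinity :: "(real^2^2) set \<Rightarrow> (complex \<Rightarrow> complex) set" where
  "M0_weak_infinity G = {f \<in> weakly_holomorphic_forms 0 G.
     \<forall>A\<in>SL2Z. moebius A None \<notin> orbit G None \<longrightarrow> holomorphic_at_infinity (slash 0 f A)}"

definition S2_weak_infinity :: "(real^2^2) set \<Rightarrow> (complex \<Rightarrow> complex) set" where
  "S2_weak_infinity G = {f \<in> weakly_holomorphic_forms 2 G.
     \<forall>A\<in>SL2Z. moebius A None \<notin> orbit G None \<longrightarrow> vanishes_at_infinity (slash 2 f A)}"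

text \<open>\<open>is_f G g m f a\<close>: \<open>f\<close> is the function \<open>f\<^sub>m\<close> in \<open>M0_weak_infinity G\<close>, and \<open>a n\<close> is
  its \<open>n\<close>-th Fourier coefficient; in particular \<open>a(m,n) = a n\<close> for \<open>n \<ge> -g\<close>.\<close>

definition is_f ::
    "(real^2^2) set \<Rightarrow> nat \<Rightarrow> int \<Rightarrow> (complex \<Rightarrow> complex) \<Rightarrow> (int \<Rightarrow> complex) \<Rightarrow> bool" where
  "is_f G g m f a \<longleftrightarrow> f \<in> M0_weak_infinity G \<and> has_q_expansion 1 f a
     \<and> a (-m) = 1 \<and> a 0 = 0 \<and> (\<forall>k. k < - int g \<longrightarrow> k \<noteq> -m \<longrightarrow> a k = 0)"

text \<open>\<open>is_h G g n h b\<close>: \<open>h\<close> is the form \<open>h\<^sub>n\<close> in \<open>S2_weak_infinity G\<close>, and \<open>b m\<close> is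
  its \<open>m\<close>-th Fourier coefficient; in particular \<open>b(n,m) = b m\<close> for \<open>m \<ge> g+1\<close>. For \<open>n < 0\<close>
  the form also vanishes at infinity, so it is the basis element \<open>h\<^sub>n\<close> of the space of cusp forms.\<close>

definition is_h ::
    "(real^2^2) set \<Rightarrow> nat \<Rightarrow> int \<Rightarrow> (complex \<Rightarrow> complex) \<Rightarrow> (int \<Rightarrow> complex) \<Rightarrow> bool" where
  "is_h G g n h b \<longleftrightarrow> h \<in> S2_weak_infinity G \<and> has_q_expansion 1 h b
     \<and> b (-n) = 1 \<and> (\<forall>k. k \<le> int g \<longrightarrow> k \<noteq> -n \<longrightarrow> b k = 0)"

end

theory Submission
  imports Defs "HOL-Complex_Analysis.Cauchy_Integral_Theorem" "HOL-Real_Asymp.Real_Asymp"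
begin

text \<open>The sum \<open>b(n,m) + a(m,n)\<close> is the constant term of \<open>f h\<close>, so it has to be shown that the
  differential \<open>f h dz\<close> has no residue at infinity. Its trace to level one, a sum of
  \<open>(f h)|A\<close> over representatives \<open>A\<close> of the cosets of \<open>\<Gamma>\<^sub>0(N)\<close>, has a primitive \<open>K\<close> on the upper half plane.
  The function \<open>K\<close> is invariant under \<open>z \<mapsto> -1/z\<close> and \<open>z \<mapsto> -1/(z+1)\<close>, because each of these maps
  has a fixed point, and therefore it has period one: the integral of the trace along a horizontal
  segment of integer length is zero. As the height grows, the summands at cusps not equivalent to
  infinity contribute zero in the limit, and each of the others contributes a positive multiple of
  the constant term of \<open>f h\<close>.\<close>

section \<open>Expansions at infinity\<close>

text \<open>For \<open>n \<noteq> 0\<close> the primitive, the exponential divided by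
  \<open>\<alpha>\<close>, takes the same value at both ends, because \<open>w dvd L\<close> makes
  the segment a whole number of periods.\<close>

lemma integral_exp_period:
  fixes n :: int and w L :: nat
  assumes "w > 0" "w dvd L"
  shows "((\<lambda>x. exp (2 * of_real pi * \<i> * of_int n * Complex x y / of_nat w))
           has_integral (if n = 0 then of_nat L else 0)) {0..real L}"
proof (cases "n = 0")
  case True
  then show ?thesis
    using has_integral_const_real[of "1::complex" 0 "real L"] by (simp add: scaleR_conv_of_real)
next
  case False
  define \<alpha> where "\<alpha> = 2 * of_real pi * \<i> * of_int n / (of_nat w :: complex)"
  have \<alpha>: "\<alpha> \<noteq> 0" using False assms by (simp add: \<alpha>_def)
  obtain k where k: "L = w * k" using assms by blast
  have e: "2 * of_real pi * \<i> * of_int n * Complex x y / of_nat w = \<alpha> * of_real x + \<alpha> * (\<i> * of_real y)" for x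
    by (simp add: \<alpha>_def complex_eq_iff field_simps)
  have "((\<lambda>x. exp (\<alpha> * of_real x + \<alpha> * (\<i> * of_real y))) has_integral
      exp (\<alpha> * of_real (real L) + \<alpha> * (\<i> * of_real y)) / \<alpha> - exp (\<alpha> * of_real 0 + \<alpha> * (\<i> * of_real y)) / \<alpha>) {0..real L}"
  proof (rule fundamental_theorem_of_calculus)
    fix x assume "x \<in> {0..real L}"
    have "((\<lambda>z. exp (\<alpha> * z + \<alpha> * (\<i> * of_real y)) / \<alpha>) has_field_derivative exp (\<alpha> * of_real x + \<alpha> * (\<i> * of_real y))) (at (of_real x))"
      using \<alpha> by (auto intro!: derivative_eq_intros)
    then show "((\<lambda>x. exp (\<alpha> * of_real x + \<alpha> * (\<i> * of_real y)) / \<alpha>) has_vector_derivative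
        exp (\<alpha> * of_real x + \<alpha> * (\<i> * of_real y))) (at x within {0..real L})"
      using has_vector_derivative_real_field has_vector_derivative_at_within by blast
  qed simp
  moreover have "exp (\<alpha> * of_real (real L) + \<alpha> * (\<i> * of_real y)) = exp (\<alpha> * (\<i> * of_real y))"
  proof -
    have "\<alpha> * of_real (real L) = of_int (2 * (n * int k)) * (of_real pi * \<i>)"
      using assms by (simp add: \<alpha>_def k field_simps)
    moreover have "exp (of_int (2 * (n * int k)) * (of_real pi * \<i>)) = 1"
      by (subst exp_eq_1) (auto intro!: exI[of _ "n * int k"])
    ultimately show ?thesis by (simp add: exp_add)
  qed
  ultimately show ?thesis using False by (simp add: e)
qed

lemma norm_exp_q:
  "norm (exp (2 * of_real pi * \<i> * of_int n * z / of_nat w)) = exp (- (2 * pi * of_int n * Im z / of_nat w))"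
proof -
  have "Re (2 * of_real pi * \<i> * of_int n * z / of_nat w) = - (2 * pi * of_int n * Im z / of_nat w)"
    by (simp add: Re_divide_of_nat)
  then show ?thesis by (simp add: norm_exp_eq_Re)
qed

text \<open>The norm of a term depends on \<open>z\<close> only through \<open>Im z\<close>, so its
  value at \<open>x = 0\<close> is a majorant on the whole horizontal segment and the series may be
  integrated term by term. Frequencies \<open>n i\<close> may repeat, which allows the expansion of
  a product to be indexed by pairs of exponents without collecting terms.\<close>

lemma has_sum_integral_period:
  fixes c :: "'i \<Rightarrow> complex" and n :: "'i \<Rightarrow> int" and w L :: nat
  assumes sum: "\<And>z. z \<in> upper_half_plane \<Longrightarrow>
        ((\<lambda>i. c i * exp (2 * of_real pi * \<i> * of_int (n i) * z / of_nat w)) has_sum F z) UNIV"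
    and w: "w > 0" "w dvd L" and y: "y > 0"
  shows "((\<lambda>i. if n i = 0 then of_nat L * c i else 0) has_sum integral {0..real L} (\<lambda>x. F (Complex x y))) UNIV"
proof -
  let ?t = "\<lambda>i x. c i * exp (2 * of_real pi * \<i> * of_int (n i) * Complex x y / of_nat w)"
  define M where "M i = norm (?t i 0)" for i
  have *: "Complex x y \<in> upper_half_plane" for x using y by (simp add: upper_half_plane_def)
  have "M summable_on UNIV"
    unfolding M_def by (rule summable_on_iff_abs_summable_on_complex[THEN iffD1, OF has_sum_imp_summable[OF sum[OF *]]])
  then have u: "uniform_limit {0..real L} (\<lambda>X x. \<Sum>i\<in>X. ?t i x) (\<lambda>x. F (Complex x y)) (finite_subsets_at_top UNIV)"
    by (intro Weierstrass_m_test_general'[where M=M] sum *) (auto simp: M_def norm_mult norm_exp_q)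
  have h: "((\<lambda>x. \<Sum>i\<in>X. ?t i x) has_integral (\<Sum>i\<in>X. if n i = 0 then of_nat L * c i else 0)) {0..real L}" if "finite X" for X
  proof (rule has_integral_sum[OF that])
    fix i
    from has_integral_mult_right[OF integral_exp_period[OF w, of "n i" y], of "c i"]
    show "(?t i has_integral (if n i = 0 then of_nat L * c i else 0)) {0..real L}"
      by (cases "n i = 0") (auto simp: mult.commute)
  qed
  obtain I J where IJ: "\<And>X. ((\<lambda>x. \<Sum>i\<in>X. ?t i x) has_integral I X) {0..real L}"
    "((\<lambda>x. F (Complex x y)) has_integral J) {0..real L}" "(I \<longlongrightarrow> J) (finite_subsets_at_top UNIV)"
    by (rule uniform_limit_integral[OF u]) (use w in \<open>auto intro!: continuous_intros simp: Complex_eq\<close>)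
  have "I X = (\<Sum>i\<in>X. if n i = 0 then of_nat L * c i else 0)" if "finite X" for X
    using IJ(1) h[OF that] has_integral_unique by blast
  then have "\<forall>\<^sub>F X in finite_subsets_at_top UNIV. I X = (\<Sum>i\<in>X. if n i = 0 then of_nat L * c i else 0)"
    by (auto simp: eventually_finite_subsets_at_top)
  then have "((\<lambda>X. \<Sum>i\<in>X. if n i = 0 then of_nat L * c i else 0) \<longlongrightarrow> J) (finite_subsets_at_top UNIV)"
    using IJ(3) tendsto_cong by fast
  then show ?thesis using integral_unique[OF IJ(2)] by (simp add: has_sum_def)
qed

text \<open>An unordered convergent sum of complex numbers converges absolutely, so the products of
  norms are summable over pairs and the double sum may be evaluated iteratively.\<close>

lemma has_sum_mult_complex:
  fixes f :: "'a \<Rightarrow> complex" and g :: "'b \<Rightarrow> complex"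
  assumes "(f has_sum s) A" "(g has_sum t) B"
  shows "((\<lambda>(i, j). f i * g j) has_sum s * t) (A \<times> B)"
proof (rule has_sum_SigmaI)
  show "((\<lambda>j. case (i, j) of (i, j) \<Rightarrow> f i * g j) has_sum f i * t) B" for i
    using assms(2) by (simp add: has_sum_cmult_right)
  show "((\<lambda>i. f i * t) has_sum s * t) A" using assms(1) by (simp add: has_sum_cmult_left)
  have 1: "(\<lambda>i. norm (f i)) summable_on A" "(\<lambda>j. norm (g j)) summable_on B"
    using assms has_sum_imp_summable summable_on_iff_abs_summable_on_complex by blast+
  have "(\<lambda>(i,j). norm (f i) * norm (g j)) summable_on A \<times> B"
  proof (rule summable_on_SigmaI)
    show "((\<lambda>j. case (i, j) of (i, j) \<Rightarrow> norm (f i) * norm (g j)) has_sum norm (f i) * infsum (\<lambda>j. norm (g j)) B) B" for i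
      using 1 by (simp add: has_sum_cmult_right)
    show "(\<lambda>i. norm (f i) * infsum (\<lambda>j. norm (g j)) B) summable_on A"
      using 1 by (simp add: summable_on_cmult_left)
  qed auto
  then have "(\<lambda>x. norm (case x of (i, j) \<Rightarrow> f i * g j)) summable_on A \<times> B"
    by (simp add: case_prod_unfold norm_mult)
  then show "(\<lambda>(i, j). f i * g j) summable_on A \<times> B"
    using abs_summable_summable by blast
qed

text \<open>Each term is compared with its value at \<open>\<i>\<close>: passing from height 1 to
  \<open>Im z\<close> multiplies the norm of the \<open>n\<close>-th term by
  \<open>exp (- (2 * pi * n * (Im z - 1) / w))\<close>, which for \<open>n \<ge> k\<close> is at
  most the factor belonging to \<open>k\<close>.\<close>

lemma q_expansion_decay:
  assumes "has_q_expansion w f c" "\<And>n. n < k \<Longrightarrow> c n = 0"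
  obtains C where "C \<ge> 0" "\<And>z. 1 \<le> Im z \<Longrightarrow> norm (f z) \<le> C * exp (- (2 * pi * of_int k * (Im z - 1) / of_nat w))"
proof -
  let ?t = "\<lambda>z n. c n * exp (2 * of_real pi * \<i> * of_int n * z / of_nat w)"
  have w: "w > 0" and s: "z \<in> upper_half_plane \<Longrightarrow> (?t z has_sum f z) UNIV" for z
    using assms(1) by (auto simp: has_q_expansion_def)
  define C where "C = (\<Sum>\<^sub>\<infinity>n. norm (?t \<i> n))"
  have sm: "(\<lambda>n. norm (?t z n)) summable_on UNIV" if "z \<in> upper_half_plane" for z
    by (rule summable_on_iff_abs_summable_on_complex[THEN iffD1, OF has_sum_imp_summable[OF s[OF that]]])
  have i: "\<i> \<in> upper_half_plane" by (simp add: upper_half_plane_def)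
  have "norm (f z) \<le> C * exp (- (2 * pi * of_int k * (Im z - 1) / of_nat w))" if z: "1 \<le> Im z" for z
  proof -
    let ?e = "exp (- (2 * pi * of_int k * (Im z - 1) / of_nat w))"
    have zu: "z \<in> upper_half_plane" using z by (simp add: upper_half_plane_def)
    have "norm (f z) \<le> (\<Sum>\<^sub>\<infinity>n. norm (?t z n))"
      using norm_infsum_bound[OF sm[OF zu]] infsumI[OF s[OF zu]] by simp
    also have "\<dots> \<le> (\<Sum>\<^sub>\<infinity>n. norm (?t \<i> n) * ?e)"
    proof (rule infsum_mono[OF sm[OF zu]])
      show "(\<lambda>n. norm (?t \<i> n) * ?e) summable_on UNIV" using sm[OF i] by (rule summable_on_cmult_left)
      fix n
      show "norm (?t z n) \<le> norm (?t \<i> n) * ?e"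
      proof (cases "n < k")
        case False
        have "exp (- (2 * pi * of_int n * Im z / of_nat w)) \<le> exp (- (2 * pi * of_int n * Im \<i> / of_nat w)) * ?e"
        proof -
          have "of_int k * (Im z - 1) \<le> of_int n * (Im z - 1)"
            using False z by (intro mult_right_mono) auto
          then have "2 * pi * (of_int k * (Im z - 1)) / of_nat w \<le> 2 * pi * (of_int n * (Im z - 1)) / of_nat w"
            by (intro divide_right_mono mult_left_mono) auto
          then show ?thesis by (simp add: exp_add[symmetric] algebra_simps diff_divide_distrib add_divide_distrib)
        qed
        then have "norm (c n) * exp (- (2 * pi * of_int n * Im z / of_nat w)) \<le> norm (c n) * (exp (- (2 * pi * of_int n * Im \<i> / of_nat w)) * ?e)"
          by (rule mult_left_mono) simp
        then show ?thesis unfolding norm_mult norm_exp_q by (simp add: mult.assoc)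
      qed (use assms(2) in simp)
    qed
    also have "\<dots> = C * ?e" by (simp add: C_def infsum_cmult_left')
    finally show ?thesis .
  qed
  moreover have "C \<ge> 0" unfolding C_def by (intro infsum_nonneg) simp
  ultimately show thesis using that by blast
qed

text \<open>The decay estimate with \<open>k = 0\<close> bounds \<open>p\<close>, and with
  \<open>k = 1\<close> it makes \<open>q\<close> decay exponentially. Only sizes are compared, so
  the widths of the two expansions and the length \<open>L\<close> may be unrelated.\<close>

lemma tendsto_integral_horizontal_zero:
  assumes p: "holomorphic_at_infinity p" and q: "vanishes_at_infinity q"
  shows "((\<lambda>y. integral {0..real L} (\<lambda>x. p (Complex x y) * q (Complex x y))) \<longlongrightarrow> 0) at_top"
proof -
  obtain w c where "has_q_expansion w p c" "\<And>n. n < 0 \<Longrightarrow> c n = 0"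
    using p by (auto simp: holomorphic_at_infinity_def)
  then obtain C where C: "C \<ge> 0" "\<And>z. 1 \<le> Im z \<Longrightarrow> norm (p z) \<le> C"
    by (rule q_expansion_decay) auto
  obtain w' c' where q': "has_q_expansion w' q c'" "\<And>n. n \<le> 0 \<Longrightarrow> c' n = 0"
    using q by (auto simp: vanishes_at_infinity_def)
  then have w': "w' > 0" by (simp add: has_q_expansion_def)
  have "\<And>n. n < 1 \<Longrightarrow> c' n = 0" using q' by simp
  with q' obtain D where D: "D \<ge> 0" "\<And>z. 1 \<le> Im z \<Longrightarrow> norm (q z) \<le> D * exp (- (2 * pi * of_int 1 * (Im z - 1) / of_nat w'))"
    by (metis q_expansion_decay)
  define B where "B y = C * (D * exp (- (2 * pi * (y - 1) / of_nat w')))" for y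
  have B0: "B y \<ge> 0" for y using C D by (simp add: B_def)
  show ?thesis
  proof (rule Lim_null_comparison)
    show "\<forall>\<^sub>F y in at_top. norm (integral {0..real L} (\<lambda>x. p (Complex x y) * q (Complex x y))) \<le> B y * real L"
      using eventually_ge_at_top[of 1]
    proof eventually_elim
      case (elim y)
      have "norm (p (Complex x y) * q (Complex x y)) \<le> B y" for x
        unfolding norm_mult B_def using C D(2)[of "Complex x y"] elim D(1)
        by (intro mult_mono) auto
      \<comment> \<open>The integral of a nonintegrable function is 0 by convention, so that case is
        split off from the norm bound.\<close>
      then show ?case
        using has_integral_bound_real[OF B0[of y], of "{}" _ _ 0 "real L"] B0[of y]
        by (cases "(\<lambda>x. p (Complex x y) * q (Complex x y)) integrable_on {0..real L}")
          (auto simp: not_integrable_integral dest!: integrable_integral)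
    qed
    have "filterlim (\<lambda>y. - (2 * pi * (y - 1) / real w')) at_bot at_top"
      using w' by real_asymp
    then have "((\<lambda>y. exp (- (2 * pi * (y - 1) / real w'))) \<longlongrightarrow> 0) at_top"
      using filterlim_compose[OF exp_at_bot] by blast
    from tendsto_mult_right[OF this, of "C * D * real L"]
    show "((\<lambda>y. B y * real L) \<longlongrightarrow> 0) at_top"
      by (simp add: B_def mult_ac)
  qed
qed

section \<open>The slash action\<close>

lemma mat22_nth [simp]:
  "mat22 a b c d $ 1 $ 1 = a" "mat22 a b c d $ 1 $ 2 = b"
  "mat22 a b c d $ 2 $ 1 = c" "mat22 a b c d $ 2 $ 2 = d"
  by (simp_all add: mat22_def)

lemma mat22_eqI: "A$1$1 = a \<Longrightarrow> A$1$2 = b \<Longrightarrow> A$2$1 = c \<Longrightarrow> A$2$2 = d \<Longrightarrow> A = mat22 a b c d"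
  by (simp add: vec_eq_iff forall_2)

lemma mat22_mult:
  "mat22 a b c d ** mat22 a' b' c' d' =
     mat22 (a * a' + b * c') (a * b' + b * d') (c * a' + d * c') (c * b' + d * d')"
  by (rule mat22_eqI) (simp_all add: matrix_matrix_mult_def sum_2)

lemma det_mat22 [simp]: "det (mat22 a b c d) = a * d - b * c"
  by (simp add: det_2)

lemma mat_1_mat22: "mat 1 = mat22 1 0 0 1"
  by (rule mat22_eqI) (simp_all add: mat_def)

lemma moebius_denominator_nonzero:
  fixes A :: "real^2^2"
  assumes "det A = 1" "z \<in> upper_half_plane"
  shows "of_real (A$2$1) * z + of_real (A$2$2) \<noteq> 0"
proof
  assume *: "of_real (A$2$1) * z + of_real (A$2$2) = 0"
  from arg_cong[OF this, of Im] have "A$2$1 = 0" using assms(2) by (simp add: upper_half_plane_def)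
  moreover from this * have "A$2$2 = 0" by simp
  ultimately show False using assms(1) by (simp add: det_2)
qed

lemma moebius_upper_in_upper_half_plane:
  assumes "det A = 1" "z \<in> upper_half_plane"
  shows "moebius_upper A z \<in> upper_half_plane"
proof -
  have "Im ((of_real (A$1$1) * z + of_real (A$1$2)) * cnj (of_real (A$2$1) * z + of_real (A$2$2)))
     = det A * Im z"
    by (simp add: det_2 algebra_simps)
  then show ?thesis using assms
    by (simp add: upper_half_plane_def moebius_upper_def Im_complex_div_gt_0)
qed

text \<open>This rests on the cocycle relation of the automorphy factor:
  \<open>?j (A ** B) z\<close> is \<open>?j A\<close> at the image of \<open>z\<close> under
  \<open>B\<close>, times \<open>?j B z\<close>.\<close>

lemma slash_mult:
  assumes A: "det A = 1" and B: "det B = 1" and z: "z \<in> upper_half_plane"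
  shows "slash k f (A ** B) z = slash k (slash k f A) B z"
proof -
  let ?j = "\<lambda>A z. of_real (A$2$1) * z + of_real (A$2$2) :: complex"
  have B0: "?j B z \<noteq> 0" using moebius_denominator_nonzero[OF B z] .
  have A0: "?j A (moebius_upper B z) \<noteq> 0"
    using moebius_denominator_nonzero[OF A moebius_upper_in_upper_half_plane[OF B z]] .
  have j: "?j (A ** B) z = ?j A (moebius_upper B z) * ?j B z"
    using B0 by (simp add: matrix_matrix_mult_def sum_2 moebius_upper_def field_simps)
  have "of_real ((A ** B)$1$1) * z + of_real ((A ** B)$1$2) =
      (of_real (A$1$1) * moebius_upper B z + of_real (A$1$2)) * ?j B z"
    using B0 by (simp add: matrix_matrix_mult_def sum_2 moebius_upper_def field_simps)
  then have "moebius_upper (A ** B) z = moebius_upper A (moebius_upper B z)"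
    using B0 A0 unfolding moebius_upper_def[of "A ** B"] moebius_upper_def[of A] j by simp
  then show ?thesis unfolding slash_def j power_int_mult_distrib by (simp add: mult_ac)
qed

text \<open>Hence the slash of an invariant function depends only on the coset of the matrix, as is
  needed for a trace.\<close>

lemma slash_mult_invariant:
  assumes A: "det A = 1" and B: "det B = 1" and z: "z \<in> upper_half_plane"
    and inv: "\<And>z. z \<in> upper_half_plane \<Longrightarrow> slash k f A z = f z"
  shows "slash k f (A ** B) z = slash k f B z"
  using inv[OF moebius_upper_in_upper_half_plane[OF B z]]
  by (simp add: slash_mult[OF A B z] slash_def[of k "slash k f A"] slash_def[of k f B])

lemma slash_sum: "slash k (\<lambda>z. \<Sum>i\<in>I. f i z) A z = (\<Sum>i\<in>I. slash k (f i) A z)"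
  by (simp add: slash_def sum_distrib_left)

lemma slash_mult_weights: "slash 0 f A z * slash k g A z = slash k (\<lambda>z. f z * g z) A z"
  by (simp add: slash_def)

lemma slash_holomorphic_on:
  assumes f: "f holomorphic_on upper_half_plane" and A: "det A = 1"
  shows "slash k f A holomorphic_on upper_half_plane"
proof -
  have "f \<circ> moebius_upper A holomorphic_on upper_half_plane"
    using moebius_denominator_nonzero[OF A] moebius_upper_in_upper_half_plane[OF A]
    by (intro holomorphic_on_compose_gen[OF _ f]) (auto simp: moebius_upper_def[abs_def] intro!: holomorphic_intros)
  then show ?thesis
    using moebius_denominator_nonzero[OF A]
    unfolding slash_def[abs_def] by (auto intro!: holomorphic_intros simp: o_def)
qed

section \<open>Matrices of \<open>N_plus N S\<close> as scaled integral matrices\<close>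

lemma inv_SL2R:
  assumes "a * d - b * c = 1"
  shows "inv\<^bsub>SL2R\<^esub> (mat22 a b c d) = mat22 d (- b) (- c) a"
proof (rule group.inv_equality[OF group_SL2R])
  show "mat22 d (- b) (- c) a \<otimes>\<^bsub>SL2R\<^esub> mat22 a b c d = \<one>\<^bsub>SL2R\<^esub>"
    using assms by (simp add: SL2R_def mat22_mult mat_1_mat22 algebra_simps)
qed (use assms in \<open>simp_all add: SL2R_def algebra_simps\<close>)

text \<open>These are the integral matrices of positive determinant, scaled to determinant 1.
  Neither coprime entries nor a reduced \<open>D\<close> is demanded, so a product simply multiplies
  the two values of \<open>D\<close>. Elements of \<open>N_plus N S\<close> enter the comparison of
  cusps through this form.\<close>

definition int_over_sqrt :: "(real^2^2) set" where
  "int_over_sqrt = {mat22 (of_int a / sqrt D) (of_int b / sqrt D) (of_int c / sqrt D) (of_int d / sqrt D)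
      | a b c d D. D > 0 \<and> a * d - b * c = int D}"

lemma int_over_sqrtI:
  assumes "A = mat22 (of_int a / sqrt D) (of_int b / sqrt D) (of_int c / sqrt D) (of_int d / sqrt D)"
    "D > 0" "a * d - b * c = int D"
  shows "A \<in> int_over_sqrt"
  using assms unfolding int_over_sqrt_def by blast

lemma det_int_over_sqrt: "A \<in> int_over_sqrt \<Longrightarrow> det A = 1"
proof -
  assume "A \<in> int_over_sqrt"
  then obtain a b c d :: int and D :: nat where "D > 0" "a * d - b * c = int D"
    "A = mat22 (of_int a / sqrt D) (of_int b / sqrt D) (of_int c / sqrt D) (of_int d / sqrt D)"
    unfolding int_over_sqrt_def by blast
  moreover from this have "of_int (a * d - b * c) = real D" by simp
  ultimately show ?thesis by (simp add: field_simps)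
qed

lemma int_over_sqrt_mult:
  assumes "A \<in> int_over_sqrt" "B \<in> int_over_sqrt"
  shows "A ** B \<in> int_over_sqrt"
proof -
  obtain a b c d :: int and D :: nat where 1: "D > 0" "a * d - b * c = int D"
    "A = mat22 (of_int a / sqrt D) (of_int b / sqrt D) (of_int c / sqrt D) (of_int d / sqrt D)"
    using assms(1) unfolding int_over_sqrt_def by blast
  obtain a' b' c' d' :: int and D' :: nat where 2: "D' > 0" "a' * d' - b' * c' = int D'"
    "B = mat22 (of_int a' / sqrt D') (of_int b' / sqrt D') (of_int c' / sqrt D') (of_int d' / sqrt D')"
    using assms(2) unfolding int_over_sqrt_def by blast
  show ?thesis
  proof (rule int_over_sqrtI)
    show "A ** B = mat22 (of_int (a * a' + b * c') / sqrt (D * D')) (of_int (a * b' + b * d') / sqrt (D * D'))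
      (of_int (c * a' + d * c') / sqrt (D * D')) (of_int (c * b' + d * d') / sqrt (D * D'))"
      unfolding 1(3) 2(3) mat22_mult by (simp add: real_sqrt_mult add_divide_distrib)
    show "D * D' > 0" using 1 2 by simp
    show "(a * a' + b * c') * (c * b' + d * d') - (a * b' + b * d') * (c * a' + d * c') = int (D * D')"
      unfolding of_nat_mult 1(2)[symmetric] 2(2)[symmetric] by (simp add: algebra_simps)
  qed
qed

lemma int_over_sqrt_inv:
  assumes "A \<in> int_over_sqrt"
  shows "inv\<^bsub>SL2R\<^esub> A \<in> int_over_sqrt"
proof -
  obtain a b c d :: int and D :: nat where 1: "D > 0" "a * d - b * c = int D"
    "A = mat22 (of_int a / sqrt D) (of_int b / sqrt D) (of_int c / sqrt D) (of_int d / sqrt D)"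
    using assms(1) unfolding int_over_sqrt_def by blast
  show ?thesis
  proof (rule int_over_sqrtI[of _ d D "- b" "- c" a])
    show "inv\<^bsub>SL2R\<^esub> A = mat22 (of_int d / sqrt D) (of_int (- b) / sqrt D) (of_int (- c) / sqrt D) (of_int a / sqrt D)"
      using det_int_over_sqrt[OF assms] unfolding 1(3) det_mat22 by (subst inv_SL2R) simp_all
  qed (use 1 in \<open>auto simp: algebra_simps\<close>)
qed

lemma Gamma0_int_over_sqrt: "Gamma0 N \<subseteq> int_over_sqrt"
proof
  fix A assume "A \<in> Gamma0 N"
  then obtain a b c d :: int where "a * d - b * c = 1" "A = mat22 (of_int a) (of_int b) (of_int c) (of_int d)"
    unfolding Gamma0_def by blast
  then show "A \<in> int_over_sqrt" by (intro int_over_sqrtI[of _ a 1 b c d]) auto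
qed

lemma Atkin_Lehner_int_over_sqrt:
  assumes "Q > 0"
  shows "Atkin_Lehner N Q \<subseteq> int_over_sqrt"
proof
  fix A assume "A \<in> Atkin_Lehner N Q"
  then obtain x y z w :: int where "(int Q * x) * (int Q * w) - y * (int N * z) = int Q"
    "A = mat22 (of_int (int Q * x) / sqrt Q) (of_int y / sqrt Q)
            (of_int (int N * z) / sqrt Q) (of_int (int Q * w) / sqrt Q)"
    unfolding Atkin_Lehner_def by blast
  with assms show "A \<in> int_over_sqrt" by (intro int_over_sqrtI) auto
qed

lemma N_plus_int_over_sqrt:
  assumes "N > 0" "S \<subseteq> exact_divisors N"
  shows "N_plus N S \<subseteq> int_over_sqrt"
proof
  have gen: "A \<in> int_over_sqrt" if "A \<in> Gamma0 N \<union> (\<Union>Q\<in>S. Atkin_Lehner N Q)" for A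
  proof -
    \<comment> \<open>Positivity of \<open>N\<close> excludes \<open>Q = 0\<close>, for which the
      scaling would divide by zero.\<close>
    have "Q > 0" if "Q \<in> S" for Q
      using that assms by (auto simp: exact_divisors_def intro: dvd_pos_nat)
    then show ?thesis using that Gamma0_int_over_sqrt Atkin_Lehner_int_over_sqrt by blast
  qed
  fix A assume "A \<in> N_plus N S"
  then have "A \<in> generate SL2R (Gamma0 N \<union> (\<Union>Q\<in>S. Atkin_Lehner N Q))" by (simp add: N_plus_def)
  then show "A \<in> int_over_sqrt"
  proof induction
    case one
    show ?case by (rule int_over_sqrtI[of _ 1 1 0 0 1]) (simp_all add: SL2R_def mat_1_mat22)
  next
    case (eng A B)
    then show ?case using int_over_sqrt_mult by (simp add: SL2R_def)
  qed (use gen int_over_sqrt_inv in blast)+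
qed

lemma Gamma0_subset_N_plus: "Gamma0 N \<subseteq> N_plus N S"
  by (auto simp: N_plus_def intro: generate.incl)

text \<open>The periods of \<open>f\<close> define a homomorphism from the modular group to the
  additive group of complex numbers. It vanishes because the projective modular group is generated
  by elements of orders two and three. The translation itself fixes no point of the half plane and
  is reached as a composition of these.\<close>

lemma weight_2_level_1_integral_zero:
  fixes f :: "complex \<Rightarrow> complex"
  assumes f: "f holomorphic_on upper_half_plane"
    and T: "\<And>z. z \<in> upper_half_plane \<Longrightarrow> f (z + 1) = f z"
    and S: "\<And>z. z \<in> upper_half_plane \<Longrightarrow> f (- 1 / z) = z ^ 2 * f z"
    and y: "y > 0"
  shows "integral {0..real L} (\<lambda>x. f (Complex x y)) = 0"
proof -
  let ?H = upper_half_plane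
  have H: "convex ?H" "open ?H" unfolding upper_half_plane_def
    by (simp_all add: convex_halfspace_Im_gt open_halfspace_Im_gt)
  obtain K where "\<And>z. z \<in> ?H \<Longrightarrow> (K has_field_derivative f z) (at z within ?H)"
    using holomorphic_convex_primitive'[OF H f] by blast
  then have K: "(K has_field_derivative f z) (at z)" if "z \<in> ?H" for z
    using that H(2) at_within_open by metis
  have inv: "- 1 / z \<in> ?H" if "z \<in> ?H" for z
    using that unfolding upper_half_plane_def mem_Collect_eq Im_complex_div_gt_0 by simp
  have z0: "z \<noteq> 0" if "z \<in> ?H" for z using that by (auto simp: upper_half_plane_def)
  \<comment> \<open>Weight two enters here: the derivative \<open>1 / z ^ 2\<close> of
    \<open>- 1 / z\<close> cancels the factor \<open>z ^ 2\<close> in \<open>S\<close>.\<close>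
  have KS': "((\<lambda>z. K (- 1 / z)) has_field_derivative f z) (at z)" if z: "z \<in> ?H" for z
  proof -
    have "((\<lambda>z. - 1 / z) has_field_derivative 1 / z ^ 2) (at z)"
      using z0[OF z] by (auto intro!: derivative_eq_intros simp: power2_eq_square)
    from DERIV_chain'[OF this K[OF inv[OF z]]] show ?thesis
      using z0[OF z] S[OF z] by simp
  qed
  have KS: "K (- 1 / z) = K z" if z: "z \<in> ?H" for z
  proof -
    have "((\<lambda>z. K (- 1 / z) - K z) has_field_derivative 0) (at z within ?H)" if "z \<in> ?H" for z
      using DERIV_diff[OF KS'[OF that] K[OF that]] by (simp add: has_field_derivative_at_within)
    then obtain c where c: "\<And>z. z \<in> ?H \<Longrightarrow> K (- 1 / z) - K z = c"
      using has_field_derivative_zero_constant[OF H(1), of "\<lambda>z. K (- 1 / z) - K z"] by blast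
    \<comment> \<open>The constant \<open>c\<close> is zero because \<open>\<i>\<close> is fixed by
      \<open>- 1 / z\<close>.\<close>
    have "\<i> \<in> ?H" by (simp add: upper_half_plane_def)
    from c[OF this] c[OF z] show ?thesis by simp
  qed
  have shift: "z + 1 \<in> ?H" if "z \<in> ?H" for z using that by (simp add: upper_half_plane_def)
  have KST: "K (- 1 / (z + 1)) = K z" if z: "z \<in> ?H" for z
  proof -
    have "((\<lambda>z. K (- 1 / (z + 1)) - K z) has_field_derivative 0) (at z within ?H)" if "z \<in> ?H" for z
    proof -
      have "((\<lambda>z. K (- 1 / (z + 1))) has_field_derivative f (z + 1)) (at z)"
        using KS'[OF shift[OF that]] by (rule DERIV_shift[THEN iffD1])
      from DERIV_diff[OF this K[OF that]] show ?thesis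
        using T[OF that] by (simp add: has_field_derivative_at_within)
    qed
    then obtain c where c: "\<And>z. z \<in> ?H \<Longrightarrow> K (- 1 / (z + 1)) - K z = c"
      using has_field_derivative_zero_constant[OF H(1), of "\<lambda>z. K (- 1 / (z + 1)) - K z"] by blast
    \<comment> \<open>The primitive cube root of unity in the upper half plane, which is the fixed
      point of \<open>- 1 / (z + 1)\<close>.\<close>
    define \<rho> where "\<rho> = Complex (-1/2) (sqrt 3 / 2)"
    have r: "\<rho> \<in> ?H" by (simp add: upper_half_plane_def \<rho>_def)
    have "\<rho> * (\<rho> + 1) = -1"
      by (simp add: \<rho>_def complex_eq_iff field_simps)
    then have "- 1 / (\<rho> + 1) = \<rho>" using z0[OF shift[OF r]] by (simp add: field_simps)
    with c[OF r] c[OF z] show ?thesis by simp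
  qed
  \<comment> \<open>Both sides equal \<open>K (- 1 / (z + 1))\<close>.\<close>
  have per: "K (z + 1) = K z" if "z \<in> ?H" for z
    using KS[OF shift[OF that]] KST[OF that] by simp
  have u: "Complex x y \<in> ?H" for x using y by (simp add: upper_half_plane_def)
  have "K (Complex (real L) y) = K (Complex 0 y)"
  proof (induction L)
    case (Suc L)
    have "Complex (real (Suc L)) y = Complex (real L) y + 1" by (simp add: complex_eq_iff)
    then show ?case using Suc per[OF u] by simp
  qed simp
  moreover have "((\<lambda>x. f (Complex x y)) has_integral K (Complex (real L) y) - K (Complex 0 y)) {0..real L}"
  proof (rule fundamental_theorem_of_calculus)
    fix x
    have "((\<lambda>t. K (t + \<i> * of_real y)) has_field_derivative f (Complex x y)) (at (of_real x))"
      using K[OF u, of x] DERIV_shift[of K "f (Complex x y)" "of_real x" "\<i> * of_real y"] by (simp add: Complex_eq)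
    then show "((\<lambda>x. K (Complex x y)) has_vector_derivative f (Complex x y)) (at x within {0..real L})"
      unfolding Complex_eq using has_vector_derivative_real_field has_vector_derivative_at_within by blast
  qed simp
  ultimately show ?thesis by (simp add: integral_unique)
qed

section \<open>The trace to level one\<close>

text \<open>The lower row modulo \<open>N\<close> determines the coset \<open>\<Gamma>\<^sub>0(N)A\<close>. Several rows belong to the same
  coset, so the sum over all rows is a multiple of the sum over the cosets.\<close>

definition lower_row_mod :: "nat \<Rightarrow> real^2^2 \<Rightarrow> int \<times> int \<Rightarrow> bool" where
  "lower_row_mod N A p \<longleftrightarrow> (\<exists>a b c d :: int. a * d - b * c = 1
     \<and> A = mat22 (of_int a) (of_int b) (of_int c) (of_int d) \<and> p = (c mod int N, d mod int N))"

lemma lower_row_mod_SL2Z: "lower_row_mod N A p \<Longrightarrow> A \<in> SL2Z"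
  unfolding lower_row_mod_def Gamma0_def by force

lemma det_lower_row_mod: "lower_row_mod N A p \<Longrightarrow> det A = 1"
  using lower_row_mod_SL2Z Gamma0_int_over_sqrt det_int_over_sqrt by blast

text \<open>The matrix \<open>C\<close> is \<open>A\<close> times the inverse of \<open>B\<close>.
  Its lower left entry \<open>c * d' - d * c'\<close> is divisible by \<open>N\<close> because the
  two lower rows agree modulo \<open>N\<close>.\<close>

lemma slash_lower_row_mod_eq:
  assumes A: "lower_row_mod N A p" and B: "lower_row_mod N B p" and z: "z \<in> upper_half_plane"
    and inv: "\<And>C z. C \<in> Gamma0 N \<Longrightarrow> z \<in> upper_half_plane \<Longrightarrow> slash k f C z = f z"
  shows "slash k f A z = slash k f B z"
proof -
  obtain a b c d :: int where 1: "a * d - b * c = 1"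
    "A = mat22 (of_int a) (of_int b) (of_int c) (of_int d)" "p = (c mod int N, d mod int N)"
    using A unfolding lower_row_mod_def by blast
  obtain a' b' c' d' :: int where 2: "a' * d' - b' * c' = 1"
    "B = mat22 (of_int a') (of_int b') (of_int c') (of_int d')" "p = (c' mod int N, d' mod int N)"
    using B unfolding lower_row_mod_def by blast
  define C where "C = mat22 (of_int (a * d' - b * c')) (of_int (b * a' - a * b'))
    (of_int (c * d' - d * c')) (of_int (d * a' - c * b'))"
  have "C ** B = mat22 (of_int ((a * d' - b * c') * a' + (b * a' - a * b') * c'))
      (of_int ((a * d' - b * c') * b' + (b * a' - a * b') * d'))
      (of_int ((c * d' - d * c') * a' + (d * a' - c * b') * c'))
      (of_int ((c * d' - d * c') * b' + (d * a' - c * b') * d'))"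
    unfolding 2(2) C_def mat22_mult by simp
  also have "(a * d' - b * c') * a' + (b * a' - a * b') * c' = a * (a' * d' - b' * c')" by (simp add: algebra_simps)
  also have "(a * d' - b * c') * b' + (b * a' - a * b') * d' = b * (a' * d' - b' * c')" by (simp add: algebra_simps)
  also have "(c * d' - d * c') * a' + (d * a' - c * b') * c' = c * (a' * d' - b' * c')" by (simp add: algebra_simps)
  also have "(c * d' - d * c') * b' + (d * a' - c * b') * d' = d * (a' * d' - b' * c')" by (simp add: algebra_simps)
  finally have "A = C ** B" using 1(2) 2(1) by simp
  moreover have "int N dvd c * d' - d * c'"
  proof -
    have "c mod int N = c' mod int N" "d mod int N = d' mod int N" using 1(3) 2(3) by auto
    then have "(c * d') mod int N = (c' * d) mod int N" by (metis mod_mult_cong)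
    then show ?thesis by (simp add: mod_eq_dvd_iff mult.commute)
  qed
  moreover have "(a * d' - b * c') * (d * a' - c * b') - (b * a' - a * b') * (c * d' - d * c')
      = (a * d - b * c) * (a' * d' - b' * c')" by (simp add: algebra_simps)
  ultimately have "A = C ** B" "C \<in> Gamma0 N"
    unfolding Gamma0_def C_def 1(1) 2(1) mult_1 by blast+
  then show ?thesis
    using slash_mult_invariant[of C B z k f] z inv Gamma0_int_over_sqrt det_int_over_sqrt
      det_lower_row_mod[OF B] by blast
qed

definition lower_rows :: "nat \<Rightarrow> (int \<times> int) set" where
  "lower_rows N = {p. \<exists>A. lower_row_mod N A p}"

lemma finite_lower_rows: "N > 0 \<Longrightarrow> finite (lower_rows N)"
  by (rule finite_subset[of _ "{0..<int N} \<times> {0..<int N}"]) (auto simp: lower_rows_def lower_row_mod_def)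

text \<open>Right multiplication by \<open>M\<close> permutes the lower rows modulo
  \<open>N\<close>, and \<open>R p ** M\<close> represents the row \<open>\<sigma> p\<close>. The
  sum is therefore merely reindexed.\<close>

lemma slash_sum_lower_rows:
  fixes a b c d :: int
  assumes "N > 0" and M: "a * d - b * c = 1" "M = mat22 (of_int a) (of_int b) (of_int c) (of_int d)"
    and R: "\<And>p. p \<in> lower_rows N \<Longrightarrow> lower_row_mod N (R p) p"
    and inv: "\<And>C z. C \<in> Gamma0 N \<Longrightarrow> z \<in> upper_half_plane \<Longrightarrow> slash k f C z = f z"
    and z: "z \<in> upper_half_plane"
  shows "slash k (\<lambda>z. \<Sum>p\<in>lower_rows N. slash k f (R p) z) M z = (\<Sum>p\<in>lower_rows N. slash k f (R p) z)"
proof -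
  define \<sigma> where "\<sigma> p = ((fst p * a + snd p * c) mod int N, (fst p * b + snd p * d) mod int N)" for p
  have rep: "lower_row_mod N (R p ** M) (\<sigma> p)" if p: "p \<in> lower_rows N" for p
  proof -
    obtain a' b' c' d' :: int where 1: "a' * d' - b' * c' = 1"
      "R p = mat22 (of_int a') (of_int b') (of_int c') (of_int d')" "p = (c' mod int N, d' mod int N)"
      using R[OF p] unfolding lower_row_mod_def by blast
    have "R p ** M = mat22 (of_int (a' * a + b' * c)) (of_int (a' * b + b' * d))
        (of_int (c' * a + d' * c)) (of_int (c' * b + d' * d))"
      unfolding 1(2) M(2) mat22_mult by simp
    moreover have "(a' * a + b' * c) * (c' * b + d' * d) - (a' * b + b' * d) * (c' * a + d' * c)
        = (a' * d' - b' * c') * (a * d - b * c)" by (simp add: algebra_simps)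
    moreover have "\<sigma> p = ((c' * a + d' * c) mod int N, (c' * b + d' * d) mod int N)"
      unfolding \<sigma>_def 1(3) by (auto intro!: mod_add_cong simp: mod_mult_left_eq)
    ultimately show ?thesis unfolding lower_row_mod_def 1(1) M(1) mult_1 by blast
  qed
  have "inj_on \<sigma> (lower_rows N)"
  proof (rule inj_onI)
    fix p q assume p: "p \<in> lower_rows N" and q: "q \<in> lower_rows N" and "\<sigma> p = \<sigma> q"
    then have "int N dvd (fst p * a + snd p * c) - (fst q * a + snd q * c)"
      "int N dvd (fst p * b + snd p * d) - (fst q * b + snd q * d)"
      by (auto simp: \<sigma>_def mod_eq_dvd_iff)
    \<comment> \<open>Multiplying by the adjugate of \<open>M\<close>, whose determinant is 1,
      recovers the differences of the original rows from those of their images.\<close>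
    note dvd = dvd_mult[OF this(1)] dvd_mult[OF this(2)]
    have "int N dvd fst p - fst q"
    proof -
      have "(fst p - fst q) * (a * d - b * c) = d * ((fst p * a + snd p * c) - (fst q * a + snd q * c))
          - c * ((fst p * b + snd p * d) - (fst q * b + snd q * d))" by (simp add: algebra_simps)
      with dvd M(1) show ?thesis by (metis dvd_diff mult.right_neutral)
    qed
    moreover have "int N dvd snd p - snd q"
    proof -
      have "(snd p - snd q) * (a * d - b * c) = a * ((fst p * b + snd p * d) - (fst q * b + snd q * d))
         - b * ((fst p * a + snd p * c) - (fst q * a + snd q * c))" by (simp add: algebra_simps)
      with dvd M(1) show ?thesis by (metis dvd_diff mult.right_neutral)
    qed
    moreover have "fst p mod int N = fst p" "snd p mod int N = snd p" if "p \<in> lower_rows N" for p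
      using that by (auto simp: lower_rows_def lower_row_mod_def)
    ultimately show "p = q" using p q by (metis mod_eq_dvd_iff prod_eq_iff)
  qed
  moreover have "\<sigma> ` lower_rows N \<subseteq> lower_rows N" using rep unfolding lower_rows_def by blast
  ultimately have bij: "bij_betw \<sigma> (lower_rows N) (lower_rows N)"
    using endo_inj_surj[OF finite_lower_rows[OF \<open>N > 0\<close>]] by (simp add: bij_betw_def)
  have "of_int (a * d - b * c) = (1::real)" using M(1) by simp
  then have detM: "det M = 1" by (simp add: M(2))
  have "slash k (\<lambda>z. \<Sum>p\<in>lower_rows N. slash k f (R p) z) M z = (\<Sum>p\<in>lower_rows N. slash k f (R p ** M) z)"
    using slash_mult[OF det_lower_row_mod[OF R] detM z] by (simp add: slash_sum)
  also have "\<dots> = (\<Sum>p\<in>lower_rows N. slash k f (R (\<sigma> p)) z)"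
    using slash_lower_row_mod_eq[OF rep R[OF bij_betwE[OF bij, rule_format]] z inv] by (intro sum.cong) auto
  also have "\<dots> = (\<Sum>p\<in>lower_rows N. slash k f (R p) z)"
    by (rule sum.reindex_bij_betw[OF bij])
  finally show ?thesis .
qed

lemma integral_sum_lower_rows_zero:
  assumes N: "N > 0" and R: "\<And>p. p \<in> lower_rows N \<Longrightarrow> lower_row_mod N (R p) p"
    and inv: "\<And>C z. C \<in> Gamma0 N \<Longrightarrow> z \<in> upper_half_plane \<Longrightarrow> slash 2 f C z = f z"
    and f: "f holomorphic_on upper_half_plane" and y: "y > 0"
  shows "(\<Sum>p\<in>lower_rows N. integral {0..real L} (\<lambda>x. slash 2 f (R p) (Complex x y))) = 0"
proof -
  let ?T = "\<lambda>z. \<Sum>p\<in>lower_rows N. slash 2 f (R p) z"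
  have hol: "slash 2 f (R p) holomorphic_on upper_half_plane" if "p \<in> lower_rows N" for p
    using slash_holomorphic_on[OF f det_lower_row_mod[OF R[OF that]]] .
  have inv': "slash 2 ?T (mat22 (of_int a) (of_int b) (of_int c) (of_int d)) z = ?T z"
    if "a * d - b * c = 1" "z \<in> upper_half_plane" for a b c d z
    using slash_sum_lower_rows[OF N that(1) refl R inv that(2)] .
  have "integral {0..real L} (\<lambda>x. ?T (Complex x y)) = 0"
  proof (rule weight_2_level_1_integral_zero[OF _ _ _ y])
    show "?T holomorphic_on upper_half_plane" using hol by (rule holomorphic_on_sum)
    show "?T (z + 1) = ?T z" if "z \<in> upper_half_plane" for z
      \<comment> \<open>The positional arguments instantiate \<open>a\<close>, \<open>d\<close>,
        \<open>b\<close>, \<open>c\<close> in this order, giving the translation by 1; below, the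
        same order gives the inversion \<open>- 1 / z\<close>.\<close>
      using inv'[of 1 1 1 0 z] that by (simp add: slash_def[of 2 ?T] moebius_upper_def)
    show "?T (- 1 / z) = z ^ 2 * ?T z" if "z \<in> upper_half_plane" for z
    proof -
      have "z \<noteq> 0" using that by (auto simp: upper_half_plane_def)
      then show ?thesis
        using inv'[of 0 0 "-1" 1 z] that
        by (simp add: slash_def[of 2 ?T] moebius_upper_def power_int_minus field_simps)
    qed
  qed
  moreover have "(\<lambda>x. slash 2 f (R p) (Complex x y)) integrable_on {0..real L}" if "p \<in> lower_rows N" for p
  proof (rule integrable_continuous_interval)
    have "continuous_on {0..real L} (slash 2 f (R p) \<circ> (\<lambda>x. Complex x y))"
      by (rule continuous_on_compose)
        (use y in \<open>auto simp: Complex_eq upper_half_plane_def intro!: continuous_intros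
           continuous_on_subset[OF holomorphic_on_imp_continuous_on[OF hol[OF that]]]\<close>)
    then show "continuous_on {0..real L} (\<lambda>x. slash 2 f (R p) (Complex x y))" by (simp add: o_def)
  qed
  ultimately show ?thesis by (simp add: integral_sum finite_lower_rows N)
qed

section \<open>Cusps equivalent to infinity\<close>

lemma moebius_infinity_eqD:
  assumes "moebius A None = moebius B None"
  shows "A$1$1 * B$2$1 = B$1$1 * A$2$1"
  \<comment> \<open>The first column gives homogeneous coordinates of the image of infinity, so the
    cross-multiplied equation also covers the case where both images are
    \<open>None\<close>.\<close>
  using assms by (auto simp: moebius_def field_simps split: if_splits simp flip: of_real_mult of_real_divide)

text \<open>The inverse of \<open>B\<close> times \<open>A\<close> fixes infinity, hence is upper
  triangular. Integrality up to \<open>sqrt D\<close> makes \<open>\<alpha> ^ 2\<close> rational, so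
  that scaling by it preserves expansions in rational powers of \<open>q\<close>.\<close>

lemma infinity_equivalent_factor:
  assumes A: "A \<in> SL2Z" and B: "B \<in> int_over_sqrt" and eq: "moebius A None = moebius B None"
  obtains r :: int and D :: nat and \<alpha> \<beta> :: real where "r \<noteq> 0" "D > 0" "\<alpha> = of_int r / sqrt D"
    "A = B ** mat22 \<alpha> \<beta> 0 (1 / \<alpha>)"
proof -
  obtain a b c d :: int where 1: "a * d - b * c = 1"
    "A = mat22 (of_int a) (of_int b) (of_int c) (of_int d)"
    using A unfolding Gamma0_def by blast
  obtain a' b' c' d' :: int and D :: nat where 2: "D > 0" "a' * d' - b' * c' = int D"
    "B = mat22 (of_int a' / sqrt D) (of_int b' / sqrt D) (of_int c' / sqrt D) (of_int d' / sqrt D)"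
    using B unfolding int_over_sqrt_def by blast
  have s: "sqrt D * sqrt D = D" "sqrt D \<noteq> 0" using 2(1) by auto
  have "real_of_int (a * c') = of_int (a' * c)"
    using moebius_infinity_eqD[OF eq] s(2) unfolding 1(2) 2(3) by (simp add: field_simps)
  then have e: "a * c' = a' * c" using of_int_eq_iff by blast
  \<comment> \<open>\<open>r\<close> and \<open>t\<close> are the diagonal entries of the adjugate
    of the integral matrix behind \<open>B\<close>, times \<open>A\<close>. The lower left entry
    vanishes by \<open>e\<close>, so \<open>r * t\<close> is the determinant
    \<open>D\<close>.\<close>
  define r where "r = d' * a - b' * c"
  define t where "t = - c' * b + a' * d"
  have "r * t = (a * d - b * c) * (a' * d' - b' * c') + (a * c' - a' * c) * (b' * d - b * d')"
    unfolding r_def t_def by (simp add: algebra_simps)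
  then have rt: "r * t = int D" by (simp add: 1(1) 2(2) e)
  then have r0: "r \<noteq> 0" using 2(1) by auto
  define \<alpha> where "\<alpha> = of_int r / sqrt D"
  define \<beta> where "\<beta> = of_int (d' * b - b' * d) / sqrt D"
  have rtr: "of_int r * of_int t = real D" using rt by (metis of_int_mult of_int_of_nat_eq)
  then have t: "1 / \<alpha> = of_int t / sqrt D" using r0 s
    unfolding \<alpha>_def by (simp add: field_simps)
  have "B ** mat22 \<alpha> \<beta> 0 (1 / \<alpha>) = mat22 (of_int (a' * r) / D) (of_int (a' * (d' * b - b' * d) + b' * t) / D)
      (of_int (c' * r) / D) (of_int (c' * (d' * b - b' * d) + d' * t) / D)"
    unfolding t 2(3) mat22_mult unfolding \<alpha>_def \<beta>_def by (simp add: s add_divide_distrib)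
  also have "a' * r = a * (a' * d' - b' * c') + b' * (a * c' - a' * c)" by (simp add: r_def algebra_simps)
  also have "a' * (d' * b - b' * d) + b' * t = b * (a' * d' - b' * c')" by (simp add: t_def algebra_simps)
  also have "c' * r = c * (a' * d' - b' * c') + d' * (a * c' - a' * c)" by (simp add: r_def algebra_simps)
  also have "c' * (d' * b - b' * d) + d' * t = d * (a' * d' - b' * c')" by (simp add: t_def algebra_simps)
  finally have "A = B ** mat22 \<alpha> \<beta> 0 (1 / \<alpha>)" using 2(1) by (simp add: 1(2) 2(2) e)
  then show thesis using that r0 2(1) \<alpha>_def by blast
qed

text \<open>The slash by \<open>A\<close> is \<open>\<alpha> ^ 2\<close> times \<open>F\<close> at
  \<open>\<alpha> ^ 2 * z + \<alpha> * \<beta>\<close>. The shift only changes phases, and since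
  \<open>\<alpha> ^ 2\<close> is \<open>r ^ 2 / D\<close>, frequency \<open>n i\<close> becomes
  \<open>n i * r ^ 2\<close> at width \<open>D\<close>. The constant term is multiplied by
  \<open>t\<close>, the square of \<open>\<alpha>\<close>; its positivity later excludes
  cancellation between cosets.\<close>

lemma integral_infinity_equivalent_cusp:
  assumes A: "A \<in> SL2Z" and B: "B \<in> int_over_sqrt" and eq: "moebius A None = moebius B None"
    and inv: "\<And>z. z \<in> upper_half_plane \<Longrightarrow> slash 2 F B z = F z"
    and F: "\<And>z. z \<in> upper_half_plane \<Longrightarrow>
        ((\<lambda>i. c i * exp (2 * of_real pi * \<i> * of_int (n i) * z)) has_sum F z) UNIV"
    and c0: "((\<lambda>i. if n i = 0 then c i else 0) has_sum c0) UNIV"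
  obtains D :: nat and t :: real where "D > 0" "t > 0"
    "\<And>L y. D dvd L \<Longrightarrow> y > 0 \<Longrightarrow>
       integral {0..real L} (\<lambda>x. slash 2 F A (Complex x y)) = of_nat L * of_real t * c0"
proof -
  obtain r :: int and D :: nat and \<alpha> \<beta> :: real where P: "r \<noteq> 0" "D > 0" "\<alpha> = of_int r / sqrt D"
    "A = B ** mat22 \<alpha> \<beta> 0 (1 / \<alpha>)"
    using infinity_equivalent_factor[OF A B eq] .
  have a0: "\<alpha> \<noteq> 0" using P by simp
  have a2: "\<alpha> ^ 2 = of_int (r ^ 2) / real D" using P by (simp add: power_divide)
  have sl: "slash 2 F A z = of_real (\<alpha> ^ 2) * F (of_real (\<alpha> ^ 2) * z + of_real (\<alpha> * \<beta>))"
    if z: "z \<in> upper_half_plane" for z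
  proof -
    have "slash 2 F A z = slash 2 F (mat22 \<alpha> \<beta> 0 (1 / \<alpha>)) z"
      unfolding P(4) using a0 inv by (intro slash_mult_invariant[OF det_int_over_sqrt[OF B] _ z]) auto
    also have "\<dots> = of_real (\<alpha> ^ 2) * F (of_real (\<alpha> ^ 2) * z + of_real (\<alpha> * \<beta>))"
      using a0 by (simp add: slash_def moebius_upper_def power_int_minus field_simps power2_eq_square)
    finally show ?thesis .
  qed
  let ?c = "\<lambda>i. of_real (\<alpha> ^ 2) * c i * exp (2 * of_real pi * \<i> * of_int (n i) * of_real (\<alpha> * \<beta>))"
  let ?n = "\<lambda>i. n i * r ^ 2"
  have sum: "((\<lambda>i. ?c i * exp (2 * of_real pi * \<i> * of_int (?n i) * z / of_nat D)) has_sum slash 2 F A z) UNIV"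
    if z: "z \<in> upper_half_plane" for z
  proof -
    have "of_real (\<alpha> ^ 2) * z + of_real (\<alpha> * \<beta>) \<in> upper_half_plane"
      using z a0 by (simp add: upper_half_plane_def flip: of_real_power)
    from has_sum_cmult_right[OF F[OF this], of "of_real (\<alpha> ^ 2)"]
    have "((\<lambda>i. of_real (\<alpha> ^ 2) * (c i * exp (2 * of_real pi * \<i> * of_int (n i) * (of_real (\<alpha> ^ 2) * z + of_real (\<alpha> * \<beta>)))))
        has_sum slash 2 F A z) UNIV" by (simp only: sl[OF z])
    moreover have "of_real (\<alpha> ^ 2) * (c i * exp (2 * of_real pi * \<i> * of_int (n i) * (of_real (\<alpha> ^ 2) * z + of_real (\<alpha> * \<beta>))))
      = ?c i * exp (2 * of_real pi * \<i> * of_int (?n i) * z / of_nat D)" for i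
    proof -
      have "2 * of_real pi * \<i> * of_int (n i) * (of_real (\<alpha> ^ 2) * z + of_real (\<alpha> * \<beta>))
          = 2 * of_real pi * \<i> * of_int (n i) * of_real (\<alpha> * \<beta>) + 2 * of_real pi * \<i> * of_int (?n i) * z / of_nat D"
        unfolding a2 by (simp add: algebra_simps)
      then show ?thesis by (simp add: exp_add mult_ac)
    qed
    ultimately show ?thesis by (simp only:)
  qed
  show thesis
  proof (rule that[of D "\<alpha> ^ 2"])
    fix L :: nat and y :: real assume "D dvd L" "y > 0"
    from has_sum_integral_period[OF sum P(2) this]
    have 1: "((\<lambda>i. if ?n i = 0 then of_nat L * ?c i else 0) has_sum
        integral {0..real L} (\<lambda>x. slash 2 F A (Complex x y))) UNIV" .
    \<comment> \<open>As \<open>r\<close> is nonzero, the new frequency vanishes exactly when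
      \<open>n i\<close> does, and then the phase factor is 1.\<close>
    have "(\<lambda>i. if ?n i = 0 then of_nat L * ?c i else 0) =
        (\<lambda>i. of_nat L * of_real (\<alpha> ^ 2) * (if n i = 0 then c i else 0))"
      using P(1) by (auto simp: fun_eq_iff)
    with 1 has_sum_cmult_right[OF c0, of "of_nat L * of_real (\<alpha> ^ 2)"]
    show "integral {0..real L} (\<lambda>x. slash 2 F A (Complex x y)) = of_nat L * of_real (\<alpha> ^ 2) * c0"
      using has_sum_unique by (metis (no_types, lifting))
  qed (use P a0 in auto)
qed

text \<open>The residue theorem for the differential \<open>f h dz\<close> on the modular curve.\<close>

lemma constant_term_mult_eq_zero:
  assumes N: "N > 0" "S \<subseteq> exact_divisors N" and G: "G = N_plus N S"
    and f: "f \<in> M0_weak_infinity G" and h: "h \<in> S2_weak_infinity G"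
    and F: "\<And>z. z \<in> upper_half_plane \<Longrightarrow>
        ((\<lambda>i. c i * exp (2 * of_real pi * \<i> * of_int (n i) * z)) has_sum f z * h z) UNIV"
    and c0: "((\<lambda>i. if n i = 0 then c i else 0) has_sum c0) UNIV"
  shows "c0 = 0"
proof -
  let ?F = "\<lambda>z. f z * h z" and ?R = "lower_rows N"
  define A where "A p = (SOME A. lower_row_mod N A p)" for p
  have A: "lower_row_mod N (A p) p" if "p \<in> ?R" for p
    unfolding A_def using that by (auto simp: lower_rows_def intro: someI)
  have hol: "?F holomorphic_on upper_half_plane"
    using f h by (auto simp: M0_weak_infinity_def S2_weak_infinity_def weakly_holomorphic_forms_def intro!: holomorphic_intros)
  have inv: "slash 2 ?F B z = ?F z" if "B \<in> G" "z \<in> upper_half_plane" for B z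
    using f h that
    by (simp add: M0_weak_infinity_def S2_weak_infinity_def weakly_holomorphic_forms_def flip: slash_mult_weights)
  \<comment> \<open>On \<open>E\<close> the integrals do not depend on the height; off
    \<open>E\<close> they tend to zero.\<close>
  define E where "E = {p \<in> ?R. moebius (A p) None \<in> orbit G None}"
  have fin: "finite ?R" using finite_lower_rows[OF N(1)] .
  define Q where "Q p D t \<longleftrightarrow> D > 0 \<and> t > 0 \<and> (\<forall>L y. D dvd L \<longrightarrow> y > 0 \<longrightarrow>
       integral {0..real L} (\<lambda>x. slash 2 ?F (A p) (Complex x y)) = of_nat L * of_real t * c0)"
    for p and D :: nat and t :: real
  have "\<exists>D t. Q p D t" if p: "p \<in> E" for p
  proof -
    obtain B where B: "B \<in> G" "moebius (A p) None = moebius B None"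
      using p by (auto simp: E_def orbit_def)
    have "A p \<in> SL2Z" using p lower_row_mod_SL2Z[OF A] by (simp add: E_def)
    moreover have "B \<in> int_over_sqrt" using B(1) N_plus_int_over_sqrt[OF N] G by blast
    ultimately obtain D :: nat and t where "D > 0" "t > 0" "\<And>L y. D dvd L \<Longrightarrow> y > 0 \<Longrightarrow>
       integral {0..real L} (\<lambda>x. slash 2 ?F (A p) (Complex x y)) = of_nat L * of_real t * c0"
      using integral_infinity_equivalent_cusp[OF _ _ B(2) inv[OF B(1)] F c0] by metis
    then show ?thesis unfolding Q_def by blast
  qed
  then obtain D t where DQ: "\<And>p. p \<in> E \<Longrightarrow> Q p (D p) (t p)" by metis
  then have D : "\<And>p. p \<in> E \<Longrightarrow> D p > 0" "\<And>p. p \<in> E \<Longrightarrow> t p > 0"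
    "\<And>p L y. p \<in> E \<Longrightarrow> D p dvd L \<Longrightarrow> y > 0 \<Longrightarrow>
       integral {0..real L} (\<lambda>x. slash 2 ?F (A p) (Complex x y)) = of_nat L * of_real (t p) * c0"
    by (simp_all add: Q_def)
  \<comment> \<open>A common multiple of the widths, so that one segment serves all rows in
    \<open>E\<close>.\<close>
  define L where "L = (\<Prod>p\<in>E. D p)"
  have finE: "finite E" using fin by (simp add: E_def)
  have L: "L > 0" using D(1) by (auto simp: L_def intro: prod_pos)
  have DL: "D p dvd L" if "p \<in> E" for p using that finE by (simp add: L_def dvd_prodI)
  let ?I = "\<lambda>y p. integral {0..real L} (\<lambda>x. slash 2 ?F (A p) (Complex x y))"
  have z: "((\<lambda>y. ?I y p) \<longlongrightarrow> 0) at_top" if "p \<in> ?R - E" for p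
  proof -
    have "moebius (A p) None \<notin> orbit G None" "A p \<in> SL2Z"
      using that lower_row_mod_SL2Z[OF A] by (simp_all add: E_def)
    then have "holomorphic_at_infinity (slash 0 f (A p))" "vanishes_at_infinity (slash 2 h (A p))"
      using f h by (auto simp: M0_weak_infinity_def S2_weak_infinity_def)
    from tendsto_integral_horizontal_zero[OF this, of L] show ?thesis
      by (simp add: slash_mult_weights)
  qed
  \<comment> \<open>The vanishing of the full sum makes the part off \<open>E\<close> independent of
    the height, while its limit is zero; hence it is zero.\<close>
  have "\<forall>\<^sub>F y in at_top. (\<Sum>p\<in>?R - E. ?I y p) = - (of_nat L * of_real (\<Sum>p\<in>E. t p) * c0)"
    using eventually_gt_at_top[of 0]
  proof eventually_elim
    case (elim y)
    have "(\<Sum>p\<in>?R. ?I y p) = 0"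
      using integral_sum_lower_rows_zero[OF N(1) A _ hol elim] inv Gamma0_subset_N_plus G by blast
    moreover have "(\<Sum>p\<in>?R. ?I y p) = (\<Sum>p\<in>?R - E. ?I y p) + (\<Sum>p\<in>E. ?I y p)"
      by (rule sum.subset_diff[OF _ fin]) (auto simp: E_def)
    moreover have "(\<Sum>p\<in>E. ?I y p) = of_nat L * of_real (\<Sum>p\<in>E. t p) * c0"
      using D(3)[OF _ DL elim] by (simp add: sum_distrib_left sum_distrib_right)
    ultimately show ?case by (simp add: eq_neg_iff_add_eq_0)
  qed
  moreover have "((\<lambda>y. \<Sum>p\<in>?R - E. ?I y p) \<longlongrightarrow> 0) at_top"
    using tendsto_sum[of "?R - E", OF z] by simp
  ultimately have "((\<lambda>y::real. - (of_nat L * of_real (\<Sum>p\<in>E. t p) * c0)) \<longlongrightarrow> 0) at_top"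
    using tendsto_cong by fast
  then have 0: "of_nat L * of_real (\<Sum>p\<in>E. t p) * c0 = 0"
    by (simp add: tendsto_const_iff)
  \<comment> \<open>The row of the identity shows that \<open>E\<close> is nonempty. It is written
    \<open>1 mod int N\<close> because this is 0 for \<open>N = 1\<close>. The chosen representative
    need not be the identity, but it lies in \<open>Gamma0 N\<close>.\<close>
  have "(0, 1 mod int N) \<in> E"
  proof -
    let ?p = "(0, 1 mod int N)"
    have "lower_row_mod N (mat22 (of_int 1) (of_int 0) (of_int 0) (of_int 1)) ?p"
      unfolding lower_row_mod_def
      by (rule exI[of _ 1], rule exI[of _ 0], rule exI[of _ 0], rule exI[of _ 1]) simp
    then have p: "?p \<in> ?R" by (auto simp: lower_rows_def)
    then obtain a b c d :: int where 1: "a * d - b * c = 1"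
      "A ?p = mat22 (of_int a) (of_int b) (of_int c) (of_int d)" "0 = c mod int N"
      using A[OF p] unfolding lower_row_mod_def by blast
    then have "int N dvd c" by (simp add: dvd_eq_mod_eq_0)
    with 1 have "A ?p \<in> Gamma0 N" unfolding Gamma0_def by blast
    then have "A ?p \<in> G" using Gamma0_subset_N_plus G by blast
    then show ?thesis using p by (auto simp: E_def orbit_def)
  qed
  then have "(\<Sum>p\<in>E. t p) > 0" using D(2) finE by (intro sum_pos) auto
  then have "complex_of_real (\<Sum>p\<in>E. t p) \<noteq> 0" by (metis less_irrefl of_real_eq_0_iff)
  with 0 L show ?thesis by (simp del: of_real_sum)
qed

section \<open>Reading off the duality from the constant term\<close>

theorem theorem1p12:
  fixes N :: nat and S :: "nat set" and G :: "(real^2^2) set" and g :: nat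
    and m n :: int and f h :: "complex \<Rightarrow> complex" and a b :: "int \<Rightarrow> complex"
  assumes "N > 0" and "S \<subseteq> exact_divisors N"
    and "G = N_plus N S"
    and "g = genus (modular_curve G)"
    and "\<not> weierstrass_point (modular_curve G) (modular_curve_holomorphic G) (orbit G None)"
    and "m \<ge> int g + 1" and "n \<ge> - int g"
    and "is_f G g m f a"
    and "is_h G g n h b"
  shows "a n = - b m"
proof -
  have f: "f \<in> M0_weak_infinity G" "has_q_expansion 1 f a" "a (- m) = 1" "a 0 = 0"
    "\<And>k. k < - int g \<Longrightarrow> k \<noteq> - m \<Longrightarrow> a k = 0"
    using \<open>is_f G g m f a\<close> by (auto simp: is_f_def)
  have h: "h \<in> S2_weak_infinity G" "has_q_expansion 1 h b" "b (- n) = 1"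
    "\<And>k. k \<le> int g \<Longrightarrow> k \<noteq> - n \<Longrightarrow> b k = 0"
    using \<open>is_h G g n h b\<close> by (auto simp: is_h_def)
  let ?c = "\<lambda>(k, l). a k * b l" and ?n = "\<lambda>(k, l). k + l :: int"
  have F: "((\<lambda>i. ?c i * exp (2 * of_real pi * \<i> * of_int (?n i) * z)) has_sum f z * h z) UNIV"
    if "z \<in> upper_half_plane" for z
  proof -
    have "((\<lambda>k. a k * exp (2 * of_real pi * \<i> * of_int k * z)) has_sum f z) UNIV"
      "((\<lambda>k. b k * exp (2 * of_real pi * \<i> * of_int k * z)) has_sum h z) UNIV"
      using f(2) h(2) that by (auto simp: has_q_expansion_def)
    from has_sum_mult_complex[OF this] show ?thesis
      by (simp add: case_prod_unfold exp_add algebra_simps)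
  qed
  \<comment> \<open>The gaps of the two expansions are complementary: when \<open>k + l = 0\<close>,
    either \<open>k < - int g\<close>, where \<open>a\<close> survives only at \<open>- m\<close>,
    or \<open>l \<le> int g\<close>, where \<open>b\<close> survives only at
    \<open>- n\<close>.\<close>
  have "((\<lambda>i. if ?n i = 0 then ?c i else 0) has_sum (\<Sum>i\<in>{(- m, m), (n, - n)}. if ?n i = 0 then ?c i else 0)) UNIV"
  proof (rule has_sum_finite_neutralI)
    fix i assume i: "i \<in> UNIV - {(- m, m), (n, - n)}"
    obtain k l where kl: "i = (k, l)" by fastforce
    have "a k * b l = 0" if "k + l = 0"
    proof (cases "k < - int g")
      case True
      then show ?thesis using f(5)[of k] i kl that by auto
    next
      case False
      then show ?thesis using h(4)[of l] i kl that by auto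
    qed
    then show "(if ?n i = 0 then ?c i else 0) = 0" by (simp add: kl)
  qed auto
  \<comment> \<open>Since \<open>- m < - int g \<le> n\<close>, the pairs contribute two separate
    terms, \<open>b m\<close> and \<open>a n\<close>.\<close>
  moreover have "(- m, m) \<noteq> (n, - n)" using \<open>m \<ge> int g + 1\<close> \<open>n \<ge> - int g\<close> by auto
  ultimately have "((\<lambda>i. if ?n i = 0 then ?c i else 0) has_sum b m + a n) UNIV"
    by (simp add: f(3) h(3))
  from constant_term_mult_eq_zero[OF assms(1-3) f(1) h(1) F this]
  show ?thesis by (simp add: eq_neg_iff_add_eq_0 add.commute)
qed

end
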